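(* Let $G$ and $H$ be connected graphs. Then \[ \pi(G\boxtimes H) \le \frac{3}{2}\, (\pi(G)+1)(\pi(H)+1). \]
   Context: All graphs are finite, simple, and have at least one vertex. A configuration on a connected graph $F$ is a placement of pebbles on its vertices (a function $V(F)\to\mathbb{Z}_{\ge 0}$); its size is the total number of pebbles. A pebbling move removes two pebbles from a vertex $u$ carrying at least two pebbles and places one pebble on a vertex adjacent to $u$. Given a root vertex $r$, a configuration is $r$-solvable if, after some finite (possibly empty) sequence of pebbling moves, there is at least one pebble on $r$. The pebbling number $\pi(F)$ is the least number $n$ such that, for every root $r\in V(F)$, every configuration of size $n$ is $r$-solvable. The strong product $G \boxtimes H$ is the graph with vertex set $V(G)\times V(H)$ in which $(g,h)$ and $(g',h')$ are adjacent exactly when one of the following holds: ($g=g'$ and $h,h'$ are adjacent in $H$); ($h=h'$ and $g,g'$ are adjacent in $G$); or ($g,g'$ are adjacent in $G$ and $h,h'$ are adjacent in $H$). *)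

theory Defs
  imports Complex_Main "Graph_Theory.Graph_Theory"
begin

text \<open>
  Finite simple graphs are rendered by the locale \<^locale>\<open>pair_graph\<close>: a finite vertex set
  with a symmetric, irreflexive set of arcs between vertices.  Connectedness is the library
  predicate \<^const>\<open>connected\<close>, which includes that the vertex set is nonempty.
\<close>

text \<open>
  Configurations are total functions on the vertex type, so they are required to vanish
  outside the vertex set.
\<close>

definition configuration :: "'a pair_pre_digraph \<Rightarrow> ('a \<Rightarrow> nat) \<Rightarrow> bool" where
  "configuration F c \<longleftrightarrow> (\<forall>v. v \<notin> pverts F \<longrightarrow> c v = 0)"

definition config_size :: "'a pair_pre_digraph \<Rightarrow> ('a \<Rightarrow> nat) \<Rightarrow> nat" where
  "config_size F c = (\<Sum>v\<in>pverts F. c v)"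

inductive pebbling_move :: "'a pair_pre_digraph \<Rightarrow> ('a \<Rightarrow> nat) \<Rightarrow> ('a \<Rightarrow> nat) \<Rightarrow> bool"
  for F :: "'a pair_pre_digraph" where
  "(u, v) \<in> parcs F \<Longrightarrow> 2 \<le> c u \<Longrightarrow> pebbling_move F c (c(u := c u - 2, v := c v + 1))"

definition solvable :: "'a pair_pre_digraph \<Rightarrow> 'a \<Rightarrow> ('a \<Rightarrow> nat) \<Rightarrow> bool" where
  "solvable F r c \<longleftrightarrow> (\<exists>c'. (pebbling_move F)\<^sup>*\<^sup>* c c' \<and> 1 \<le> c' r)"

text \<open>
  For a connected finite graph some such \<open>n\<close> exists (if \<open>n > |V| (2\<^sup>d - 1)\<close> with \<open>d\<close> the
  diameter, some vertex carries at least \<open>2\<^sup>d\<close> pebbles), so the minimum is genuine.  On other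
  graphs the value is meaningless.
\<close>

definition pebbling_number :: "'a pair_pre_digraph \<Rightarrow> nat" where
  "pebbling_number F =
    (LEAST n. \<forall>r \<in> pverts F. \<forall>c. configuration F c \<and> config_size F c = n \<longrightarrow> solvable F r c)"

definition strong_product ::
    "'a pair_pre_digraph \<Rightarrow> 'b pair_pre_digraph \<Rightarrow> ('a \<times> 'b) pair_pre_digraph"
    (infixl \<open>\<boxtimes>\<close> 70) where
  "G \<boxtimes> H = \<lparr> pverts = pverts G \<times> pverts H,
     parcs = {((g, h), (g', h')) | g h g' h'.
       g \<in> pverts G \<and> g' \<in> pverts G \<and> h \<in> pverts H \<and> h' \<in> pverts H \<and>
       (g = g' \<and> (h, h') \<in> parcs H \<or>
        h = h' \<and> (g, g') \<in> parcs G \<or>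
        (g, g') \<in> parcs G \<and> (h, h') \<in> parcs H)} \<rparr>"

end

theory Submission
  imports Defs
begin

text \<open>
  Write \<open>p\<close> and \<open>q\<close> for the pebbling numbers of \<open>G\<close> and \<open>H\<close>, and view the strong product as
  a family of copies of \<open>H\<close>, the fibres, indexed by the vertices of \<open>G\<close>.  The root is \<open>(g, r)\<close>.

  The usual argument for products spends \<open>q\<close> pebbles of a fibre to put one pebble on its
  vertex with second coordinate \<open>r\<close>, and then solves \<open>G\<close> in the copy at height \<open>r\<close>.  In the
  strong product the first step in \<open>G\<close> is free: if \<open>r\<close> is empty, the solution in the fibre ends
  with a move into \<open>r\<close>, and that move can be made diagonally into any neighbouring fibre
  instead.  Two pebbles on \<open>r\<close> can make such a move at once, and a single one can be ignored at
  the cost of one pebble.  So any \<open>q + 1\<close> pebbles of a fibre put one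
  pebble at height \<open>r\<close> of any neighbouring fibre (\<open>fibre_to_neighbour_fibre\<close>).  An ordinary move
  in \<open>G\<close> consumes two pebbles to achieve the same, so a block of \<open>q + 1\<close> pebbles is worth
  \<^emph>\<open>two\<close> pebbles of \<open>G\<close>; a solution in \<open>G\<close> can be followed move by move under this exchange
  rate (\<open>simulate_move\<close>).

  Hence about \<open>p / 2\<close> blocks suffice.  Cutting the fibres into blocks leaves at most \<open>q\<close>
  pebbles in each, and \<open>G\<close> has at most \<open>p\<close> vertices, so \<open>(q + 1) (p + 1) / 2 + p q\<close> pebbles are
  enough, which is below the claimed bound.
\<close>

section \<open>Monotonicity of pebbling\<close>

lemma pebbling_moves_add:
  assumes "(pebbling_move F)\<^sup>*\<^sup>* c c'"
  shows "(pebbling_move F)\<^sup>*\<^sup>* (\<lambda>v. c v + z v) (\<lambda>v. c' v + z v)"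
  using assms
proof induction
  case base
  then show ?case by simp
next
  case (step b b')
  from step.hyps(2) have "pebbling_move F (\<lambda>v. b v + z v) (\<lambda>v. b' v + z v)"
  proof cases
    case (1 u v)
    let ?bz = "\<lambda>w. b w + z w"
    have "pebbling_move F ?bz (?bz(u := ?bz u - 2, v := ?bz v + 1))"
      using 1 by (intro pebbling_move.intros) auto
    also have "?bz(u := ?bz u - 2, v := ?bz v + 1) = (\<lambda>w. b' w + z w)"
      using 1 by (auto simp: fun_eq_iff)
    finally show ?thesis .
  qed
  with step.IH show ?case by (simp add: rtranclp.rtrancl_into_rtrancl)
qed

text \<open>
  The surplus pebbles are carried along untouched, and the bound on \<open>d'\<close> keeps track of them.
\<close>

lemma pebbling_moves_mono:
  assumes "(pebbling_move F)\<^sup>*\<^sup>* c c'" and "\<And>v. c v \<le> d v"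
  obtains d' where "(pebbling_move F)\<^sup>*\<^sup>* d d'" and "\<And>v. c' v + (d v - c v) \<le> d' v"
proof -
  have "(\<lambda>v. c v + (d v - c v)) = d"
    using assms(2) by (auto simp: fun_eq_iff)
  with pebbling_moves_add[OF assms(1), of "\<lambda>v. d v - c v"] that show ?thesis
    by fastforce
qed

lemma solvable_mono:
  assumes "solvable F r c" and "\<And>v. c v \<le> d v"
  shows "solvable F r d"
proof -
  obtain c' where c': "(pebbling_move F)\<^sup>*\<^sup>* c c'" "1 \<le> c' r"
    using assms(1) unfolding solvable_def by blast
  obtain d' where d': "(pebbling_move F)\<^sup>*\<^sup>* d d'" "\<And>v. c' v + (d v - c v) \<le> d' v"
    using pebbling_moves_mono[OF c'(1)] assms(2) by blast
  have "1 \<le> d' r" using c'(2) d'(2)[of r] by linarith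
  with d'(1) show ?thesis unfolding solvable_def by blast
qed

lemma solvable_prepend_moves:
  assumes "(pebbling_move F)\<^sup>*\<^sup>* c d" and "solvable F r d"
  shows "solvable F r c"
  using assms unfolding solvable_def by (meson rtranclp_trans)

lemma subconfiguration_exists:
  fixes f :: "'a \<Rightarrow> nat"
  assumes "finite A" and "n \<le> (\<Sum>v\<in>A. f v)"
  shows "\<exists>d. (\<forall>v. d v \<le> f v) \<and> (\<forall>v. v \<notin> A \<longrightarrow> d v = 0) \<and> (\<Sum>v\<in>A. d v) = n"
  using assms(2)
proof (induction n)
  case 0
  show ?case by (intro exI[of _ "\<lambda>_. 0"]) simp
next
  case (Suc n)
  then obtain d where d: "\<forall>v. d v \<le> f v" "\<forall>v. v \<notin> A \<longrightarrow> d v = 0" "(\<Sum>v\<in>A. d v) = n"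
    by auto
  have "\<not> (\<forall>v\<in>A. f v \<le> d v)"
    using sum_mono[of A f d] d(3) Suc.prems by auto
  then obtain v where v: "v \<in> A" "d v < f v" by auto
  have "(\<Sum>w\<in>A. (d(v := d v + 1)) w) = (\<Sum>w\<in>A. d w) + 1"
    using v(1) assms(1) by (simp add: sum.remove)
  with d v show ?case by (intro exI[of _ "d(v := d v + 1)"]) auto
qed

section \<open>Pebbling numbers of connected graphs\<close>

text \<open>
  Halving at every step of a walk still delivers a pebble if the heap is large enough.  This is
  what makes pebbling numbers exist, so that the minimum defining them is attained.
\<close>

lemma heap_solvable:
  assumes "pair_wf_digraph F" and "u \<rightarrow>\<^sup>*\<^bsub>with_proj F\<^esub> r"
  shows "\<exists>k. \<forall>c. k \<le> c u \<longrightarrow> solvable F r c"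
proof -
  interpret pair_wf_digraph F by fact
  from assms(2) show ?thesis
    unfolding reachable_def
  proof (induction rule: converse_rtrancl_on_induct)
    case base
    show ?case unfolding solvable_def by (intro exI[of _ 1]) blast
  next
    case (step u v)
    then obtain k where k: "\<And>c. k \<le> c v \<Longrightarrow> solvable F r c" by auto
    from step.hyps have arc: "(u, v) \<in> parcs F" by simp
    (* The induction on j moves one pair; the remaining 2 * j pebbles at u are then treated in
       isolation, and the pebble that has already arrived at v is added back. *)
    have carry: "\<exists>d. (pebbling_move F)\<^sup>*\<^sup>* c d \<and> j \<le> d v" if "2 * j \<le> c u" for j c
      using that
    proof (induction j arbitrary: c)
      case 0
      then show ?case by auto
    next
      case (Suc j)
      let ?c = "c(u := c u - 2, v := c v + 1)"
      have move: "pebbling_move F c ?c"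
        using arc Suc.prems by (intro pebbling_move.intros) auto
      show ?case
      proof (cases "u = v")
        case True
        then show ?thesis using Suc.prems by (intro exI[of _ c]) auto
      next
        case False
        let ?b = "(\<lambda>_. 0)(u := 2 * j)"
        obtain d where d: "(pebbling_move F)\<^sup>*\<^sup>* ?b d" "j \<le> d v"
          using Suc.IH[of ?b] by (metis fun_upd_same order_refl)
        have "?b w \<le> ?c w" for w using False Suc.prems by auto
        then obtain d' where d': "(pebbling_move F)\<^sup>*\<^sup>* ?c d'" "\<And>w. d w + (?c w - ?b w) \<le> d' w"
          using pebbling_moves_mono[OF d(1), of ?c] by blast
        have "Suc j \<le> d' v" using d'(2)[of v] d(2) False by simp
        with d'(1) move show ?thesis by (meson converse_rtranclp_into_rtranclp)
      qed
    qed
    have "solvable F r c" if large: "2 * k \<le> c u" for c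
    proof -
      from carry[of k c] large obtain d where "(pebbling_move F)\<^sup>*\<^sup>* c d \<and> k \<le> d v" by auto
      then show ?thesis using k solvable_prepend_moves[of F c d r] by simp
    qed
    then show ?case by (intro exI[of _ "2 * k"]) simp
  qed
qed

locale connected_graph = pair_graph F for F :: "'v pair_pre_digraph" +
  assumes connected: "connected F"
begin

lemma verts_nonempty: "pverts F \<noteq> {}"
  using connected by (auto simp: connected_def strongly_connected_def)

lemma reachable_if_connected:
  assumes "u \<in> pverts F" and "v \<in> pverts F"
  shows "u \<rightarrow>\<^sup>*\<^bsub>with_proj F\<^esub> v"
proof -
  have "strongly_connected (with_proj F)"
    by (rule symmetric_connected_imp_strongly_connected[OF pair_sym_arcs connected])
  then have "\<forall>u \<in> verts (with_proj F). \<forall>v \<in> verts (with_proj F). u \<rightarrow>\<^sup>*\<^bsub>with_proj F\<^esub> v"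
    unfolding strongly_connected_def by (rule conjunct2)
  moreover have "verts (with_proj F) = pverts F" by simp
  ultimately show ?thesis using assms by blast
qed

text \<open>
  By the pigeonhole principle, a large configuration has a vertex with a heap large enough to
  reach any root.
\<close>

lemma pebbling_number_exists:
  "\<exists>n. \<forall>r \<in> pverts F. \<forall>c. configuration F c \<and> config_size F c = n \<longrightarrow> solvable F r c"
proof -
  have "\<forall>p \<in> pverts F \<times> pverts F. \<exists>k. \<forall>c. k \<le> c (fst p) \<longrightarrow> solvable F (snd p) c"
  proof
    fix p assume "p \<in> pverts F \<times> pverts F"
    then have "fst p \<rightarrow>\<^sup>*\<^bsub>with_proj F\<^esub> snd p"
      by (intro reachable_if_connected) (auto simp: mem_Times_iff)
    then show "\<exists>k. \<forall>c. k \<le> c (fst p) \<longrightarrow> solvable F (snd p) c"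
      by (rule heap_solvable[OF pair_wf_digraph_axioms])
  qed
  from bchoice[OF this] obtain k where
    k: "\<And>u r c. u \<in> pverts F \<Longrightarrow> r \<in> pverts F \<Longrightarrow> k (u, r) \<le> c u \<Longrightarrow> solvable F r c"
    by fastforce
  (* A common bound for all pairs; the sum is merely a convenient substitute for the maximum. *)
  define K where "K = (\<Sum>p \<in> pverts F \<times> pverts F. k p)"
  have K: "k (u, r) \<le> K" if "u \<in> pverts F" "r \<in> pverts F" for u r
    unfolding K_def using that pair_finite_verts by (intro member_le_sum) auto
  show ?thesis
  proof (rule exI[of _ "card (pverts F) * K"], intro ballI allI impI, elim conjE)
    fix r c
    assume r: "r \<in> pverts F" and c: "config_size F c = card (pverts F) * K"
    have "\<exists>u \<in> pverts F. K \<le> c u"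
    proof (rule ccontr)
      assume "\<not> ?thesis"
      then have "(\<Sum>u \<in> pverts F. c u) < (\<Sum>u \<in> pverts F. K)"
        using verts_nonempty pair_finite_verts by (intro sum_strict_mono) auto
      with c show False by (simp add: config_size_def)
    qed
    then obtain u where "u \<in> pverts F" "K \<le> c u" by blast
    with K[of u r] r show "solvable F r c" by (intro k[of u r c]) auto
  qed
qed

lemma solvable_if_size_ge_pebbling_number:
  assumes "r \<in> pverts F" and "pebbling_number F \<le> (\<Sum>v\<in>pverts F. c v)"
  shows "solvable F r c"
proof -
  from subconfiguration_exists[OF pair_finite_verts assms(2)]
  obtain d where d: "(\<forall>v. d v \<le> c v) \<and> (\<forall>v. v \<notin> pverts F \<longrightarrow> d v = 0) \<and>
      (\<Sum>v\<in>pverts F. d v) = pebbling_number F" ..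
  let ?P = "\<lambda>n. \<forall>r \<in> pverts F. \<forall>c. configuration F c \<and> config_size F c = n \<longrightarrow> solvable F r c"
  have "?P (LEAST n. ?P n)"
    using pebbling_number_exists by (rule LeastI_ex[of ?P])
  then have "?P (pebbling_number F)"
    by (simp only: pebbling_number_def)
  then have "solvable F r d"
    using assms(1) d by (simp add: configuration_def config_size_def)
  then show ?thesis by (rule solvable_mono) (simp add: d)
qed

text \<open>
  One pebble on every vertex except the root permits no move at all.
\<close>

lemma card_verts_le_pebbling_number: "card (pverts F) \<le> pebbling_number F"
proof (rule ccontr)
  assume *: "\<not> ?thesis"
  obtain r where r: "r \<in> pverts F" using verts_nonempty by blast
  let ?c = "\<lambda>v. if v = r then 0 else 1 :: nat"
  have "(\<Sum>v\<in>pverts F. ?c v) = card (pverts F) - 1"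
    using r pair_finite_verts by (simp add: sum.remove[of _ r])
  with * have "solvable F r ?c"
    by (intro solvable_if_size_ge_pebbling_number r) simp
  then obtain c' where c': "(pebbling_move F)\<^sup>*\<^sup>* ?c c'" "1 \<le> c' r"
    unfolding solvable_def by blast
  from c'(1) have "c' = ?c"
    by (cases rule: converse_rtranclpE) (auto elim!: pebbling_move.cases split: if_splits)
  with c'(2) show False by simp
qed

end

section \<open>Pebbling inside a fibre of the strong product\<close>

definition fibre_config :: "'a \<Rightarrow> ('b \<Rightarrow> nat) \<Rightarrow> 'a \<times> 'b \<Rightarrow> nat" where
  "fibre_config g d = (\<lambda>(a, h). if a = g then d h else 0)"

lemma fibre_config_apply [simp]: "fibre_config g d (a, h) = (if a = g then d h else 0)"
  by (simp add: fibre_config_def)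

lemma fibre_moves:
  assumes "pair_wf_digraph H" and "g \<in> pverts G" and "(pebbling_move H)\<^sup>*\<^sup>* d d'"
  shows "(pebbling_move (G \<boxtimes> H))\<^sup>*\<^sup>* (fibre_config g d) (fibre_config g d')"
  using assms(3)
proof induction
  case base
  then show ?case by simp
next
  case (step b b')
  interpret H: pair_wf_digraph H by fact
  from step.hyps(2) have "pebbling_move (G \<boxtimes> H) (fibre_config g b) (fibre_config g b')"
  proof cases
    case (1 u v)
    let ?b = "fibre_config g b"
    have "pebbling_move (G \<boxtimes> H) ?b (?b((g, u) := ?b (g, u) - 2, (g, v) := ?b (g, v) + 1))"
      using 1 assms(2) H.in_arcsD1[OF 1(2)] H.in_arcsD2[OF 1(2)]
      by (intro pebbling_move.intros) (auto simp: strong_product_def)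
    also have "?b((g, u) := ?b (g, u) - 2, (g, v) := ?b (g, v) + 1) = fibre_config g b'"
      using 1 by (auto simp: fun_eq_iff)
    finally show ?thesis .
  qed
  with step.IH show ?case by (simp add: rtranclp.rtrancl_into_rtrancl)
qed

text \<open>
  The first move into an empty root starts from a vertex that carries two pebbles and is
  adjacent to the root; the configuration just before it is where the strong product can
  deviate into another fibre.
\<close>

lemma solution_last_move:
  assumes "(pebbling_move F)\<^sup>*\<^sup>* c c'" and "c r = 0" and "1 \<le> c' r"
  shows "\<exists>b u. (pebbling_move F)\<^sup>*\<^sup>* c b \<and> (u, r) \<in> parcs F \<and> 2 \<le> b u"
  using assms(1,3)
proof induction
  case base
  then show ?case using assms(2) by simp
next
  case (step b b')
  show ?case
  proof (cases "1 \<le> b r")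
    case True
    then show ?thesis by (rule step.IH)
  next
    case False
    from step.hyps(2) False step.prems show ?thesis
      by cases (use step.hyps(1) in \<open>auto split: if_splits\<close>)
  qed
qed

text \<open>
  A pair of pebbles at \<open>(g, u)\<close>, with \<open>u\<close> equal or adjacent to \<open>r\<close>, moves to \<open>(g', r)\<close> in one
  step.  Such a pair is either on \<open>r\<close> already, or it arises in the solution of the fibre after
  removing the at most one pebble from \<open>r\<close>.  That pebble is the reason for the \<open>+ 1\<close>.
\<close>

lemma fibre_to_neighbour_fibre:
  assumes "pair_graph G" and "connected_graph H"
    and arc: "(g, g') \<in> parcs G" and r: "r \<in> pverts H"
    and size: "pebbling_number H + 1 \<le> (\<Sum>h\<in>pverts H. d h)"
  shows "solvable (G \<boxtimes> H) (g', r) (fibre_config g d)"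
proof -
  interpret G: pair_graph G by fact
  interpret H: connected_graph H by fact
  note gg' = G.in_arcsD1[OF arc] G.in_arcsD2[OF arc]
  have cross: "solvable (G \<boxtimes> H) (g', r) (fibre_config g b)"
    if "2 \<le> b u" "u = r \<or> (u, r) \<in> parcs H" for b u
  proof -
    let ?b = "fibre_config g b"
    have "((g, u), (g', r)) \<in> parcs (G \<boxtimes> H)"
      using that(2) arc gg' r H.in_arcsD1[of u r] by (auto simp: strong_product_def)
    then have "pebbling_move (G \<boxtimes> H) ?b (?b((g, u) := ?b (g, u) - 2, (g', r) := ?b (g', r) + 1))"
      using that(1) by (intro pebbling_move.intros) auto
    then show ?thesis unfolding solvable_def by (intro exI conjI r_into_rtranclp) auto
  qed
  show ?thesis
  proof (cases "2 \<le> d r")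
    case True
    then show ?thesis by (intro cross) auto
  next
    case False
    let ?d = "d(r := 0)"
    have "(\<Sum>h\<in>pverts H. d h) \<le> (\<Sum>h\<in>pverts H. ?d h) + 1"
      using False r H.pair_finite_verts by (simp add: sum.remove[of _ r])
    with size have "solvable H r ?d"
      by (intro H.solvable_if_size_ge_pebbling_number r) linarith
    then obtain d' where "(pebbling_move H)\<^sup>*\<^sup>* ?d d'" "1 \<le> d' r"
      unfolding solvable_def by blast
    then obtain b u where b: "(pebbling_move H)\<^sup>*\<^sup>* ?d b" "(u, r) \<in> parcs H" "2 \<le> b u"
      using solution_last_move[of H ?d d' r] by (metis fun_upd_same)
    have "solvable (G \<boxtimes> H) (g', r) (fibre_config g ?d)"
      using fibre_moves[OF H.pair_wf_digraph_axioms gg'(1) b(1)] cross[of b u] b(2,3)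
      by (blast intro: solvable_prepend_moves)
    then show ?thesis by (rule solvable_mono) (auto simp: fibre_config_def)
  qed
qed

section \<open>Simulating a solution on the first factor\<close>

text \<open>
  \<open>x\<close> is able to imitate the configuration \<open>c\<close> of the first factor: in fibre \<open>g\<close>, the pebbles
  of \<open>y\<close> make up \<open>t g\<close> blocks of \<open>m\<close>, and disjoint from them there are \<open>e g\<close> single pebbles at
  height \<open>r\<close>.  A block counts as two pebbles of \<open>c\<close>, a single pebble as one.  Inequalities
  instead of equalities allow leftover pebbles to be forgotten.
\<close>

definition simulates ::
    "'b set \<Rightarrow> nat \<Rightarrow> 'b \<Rightarrow> ('a \<times> 'b \<Rightarrow> nat) \<Rightarrow> ('a \<Rightarrow> nat) \<Rightarrow> bool" where
  "simulates B m r x c \<longleftrightarrow> (\<exists>y t e.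
     (\<forall>g h. y (g, h) + (if h = r then e g else 0) \<le> x (g, h)) \<and>
     (\<forall>g. m * t g \<le> (\<Sum>h\<in>B. y (g, h))) \<and>
     (\<forall>g. c g \<le> 2 * t g + e g))"

text \<open>
  A move from \<open>g\<close> costs two pebbles, which are paid for by one block if there is one.  Otherwise
  \<open>g\<close> is represented by single pebbles only, two of which can move at height \<open>r\<close>.  Preferring
  blocks means that a block is never split, so no parity condition arises.  Either way the
  pebble that arrives is a single pebble.
\<close>

lemma simulate_move:
  assumes "pair_graph G" and "connected_graph H" and r: "r \<in> pverts H"
    and sim: "simulates (pverts H) (pebbling_number H + 1) r x c"
    and move: "pebbling_move G c c'"
  shows "\<exists>x'. (pebbling_move (G \<boxtimes> H))\<^sup>*\<^sup>* x x' \<and>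
    simulates (pverts H) (pebbling_number H + 1) r x' c'"
proof -
  interpret G: pair_graph G by fact
  interpret H: connected_graph H by fact
  let ?m = "pebbling_number H + 1"
  obtain y t e where y: "\<And>g h. y (g, h) + (if h = r then e g else 0) \<le> x (g, h)"
    and t: "\<And>g. ?m * t g \<le> (\<Sum>h\<in>pverts H. y (g, h))"
    and c: "\<And>g. c g \<le> 2 * t g + e g"
    using sim unfolding simulates_def by auto
  from move show ?thesis
  proof cases
    case (1 g g')
    have ne: "g \<noteq> g'" using G.pair_no_loops[OF 1(2)] by simp
    note gg' = G.in_arcsD1[OF 1(2)] G.in_arcsD2[OF 1(2)]
    show ?thesis
    proof (cases "t g = 0")
      case True
      (* No block left: an ordinary move at height r. *)
      then have e2: "2 \<le> e g" using c[of g] 1(3) by simp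
      let ?x' = "x((g, r) := x (g, r) - 2, (g', r) := x (g', r) + 1)"
      have "2 \<le> x (g, r)" using e2 y[of g r] by simp
      moreover have "((g, r), (g', r)) \<in> parcs (G \<boxtimes> H)"
        using 1(2) gg' r by (auto simp: strong_product_def)
      ultimately have "pebbling_move (G \<boxtimes> H) x ?x'"
        by (intro pebbling_move.intros)
      moreover have "simulates (pverts H) ?m r ?x' c'"
        unfolding simulates_def
      proof (intro exI conjI allI)
        let ?e = "e(g := e g - 2, g' := e g' + 1)"
        fix a h
        show "y (a, h) + (if h = r then ?e a else 0) \<le> ?x' (a, h)"
          using y[of a h] e2 ne by auto
        show "?m * t a \<le> (\<Sum>h\<in>pverts H. y (a, h))" by (rule t)
        show "c' a \<le> 2 * t a + ?e a"
          using c[of a] e2 ne 1(1) True by auto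
      qed
      ultimately show ?thesis by blast
    next
      case False
      (* Spend one block d of the fibre over g. *)
      have "?m * 1 \<le> ?m * t g" using False by (intro mult_le_mono2) simp
      then have "?m \<le> (\<Sum>h\<in>pverts H. y (g, h))" using t[of g] by (simp only: mult_1_right)
      from subconfiguration_exists[OF H.pair_finite_verts this]
      obtain d where "(\<forall>h. d h \<le> y (g, h)) \<and> (\<forall>h. h \<notin> pverts H \<longrightarrow> d h = 0) \<and>
          (\<Sum>h\<in>pverts H. d h) = ?m" ..
      then have d: "\<And>h. d h \<le> y (g, h)" "(\<Sum>h\<in>pverts H. d h) = ?m" by simp_all
      have "solvable (G \<boxtimes> H) (g', r) (fibre_config g d)"
        using fibre_to_neighbour_fibre[OF assms(1,2) 1(2) r] d(2) by simp
      then obtain b where b: "(pebbling_move (G \<boxtimes> H))\<^sup>*\<^sup>* (fibre_config g d) b" "1 \<le> b (g', r)"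
        unfolding solvable_def by blast
      have "fibre_config g d p \<le> x p" for p
        using d(1)[of "snd p"] y[of g "snd p"] by (cases p) (auto intro: le_trans)
      then obtain x' where x': "(pebbling_move (G \<boxtimes> H))\<^sup>*\<^sup>* x x'"
          "\<And>p. b p + (x p - fibre_config g d p) \<le> x' p"
        using pebbling_moves_mono[OF b(1)] by metis
      have "simulates (pverts H) ?m r x' c'"
        unfolding simulates_def
      proof (intro exI conjI allI)
        let ?y = "\<lambda>p. y p - fibre_config g d p"
        let ?t = "t(g := t g - 1)" and ?e = "e(g' := e g' + 1)"
        fix a h
        have "fibre_config g d (a, h) \<le> y (a, h)" using d(1) by simp
        moreover have "h = r \<and> a = g' \<Longrightarrow> 1 \<le> b (a, h)" using b(2) by simp
        ultimately show "?y (a, h) + (if h = r then ?e a else 0) \<le> x' (a, h)"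
          using y[of a h] x'(2)[of "(a, h)"] by (auto split: if_splits)
        have "(\<Sum>h\<in>pverts H. y (g, h) - d h) = (\<Sum>h\<in>pverts H. y (g, h)) - ?m"
          using d by (simp add: sum_subtractf_nat)
        then show "?m * ?t a \<le> (\<Sum>h\<in>pverts H. ?y (a, h))"
          using t[of a] False by (auto simp: diff_mult_distrib2 intro: diff_le_mono)
        show "c' a \<le> 2 * ?t a + ?e a"
          using c[of a] ne 1(1) False by auto
      qed
      with x'(1) show ?thesis by blast
    qed
  qed
qed

lemma simulate_moves:
  assumes "pair_graph G" and "connected_graph H" and r: "r \<in> pverts H"
    and sim: "simulates (pverts H) (pebbling_number H + 1) r x c"
    and moves: "(pebbling_move G)\<^sup>*\<^sup>* c c'"
  shows "\<exists>x'. (pebbling_move (G \<boxtimes> H))\<^sup>*\<^sup>* x x' \<and>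
    simulates (pverts H) (pebbling_number H + 1) r x' c'"
  using moves
proof induction
  case base
  then show ?case using sim by blast
next
  case (step b b')
  then show ?case using simulate_move[OF assms(1-3)] by (meson rtranclp_trans)
qed

text \<open>
  If \<open>c\<close> has a pebble on \<open>g\<close>, then fibre \<open>g\<close> has a pebble at height \<open>r\<close> or a block, and a
  block suffices to solve \<open>H\<close> inside the fibre.
\<close>

lemma simulates_solvable:
  assumes "connected_graph H" and r: "r \<in> pverts H" and g: "g \<in> pverts G"
    and sim: "simulates (pverts H) (pebbling_number H + 1) r x c" and c: "1 \<le> c g"
  shows "solvable (G \<boxtimes> H) (g, r) x"
proof -
  interpret H: connected_graph H by fact
  let ?m = "pebbling_number H + 1"
  obtain y t e where y: "\<And>g h. y (g, h) + (if h = r then e g else 0) \<le> x (g, h)"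
    and t: "\<And>g. ?m * t g \<le> (\<Sum>h\<in>pverts H. y (g, h))"
    and "\<And>g. c g \<le> 2 * t g + e g"
    using sim unfolding simulates_def by auto
  with c consider "1 \<le> e g" | "1 \<le> t g"
    by (metis One_nat_def Suc_leI add_is_0 gr0I le_zero_eq mult_0_right not_one_le_zero)
  then show ?thesis
  proof cases
    case 1
    then have "1 \<le> x (g, r)" using y[of g r] by simp
    then show ?thesis unfolding solvable_def by blast
  next
    case 2
    have "?m * 1 \<le> ?m * t g" using 2 by (rule mult_le_mono2)
    with t[of g] have "?m \<le> (\<Sum>h\<in>pverts H. y (g, h))" by (simp only: mult_1_right)
    then have "pebbling_number H \<le> (\<Sum>h\<in>pverts H. y (g, h))" by linarith
    then have "solvable H r (\<lambda>h. y (g, h))"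
      by (rule H.solvable_if_size_ge_pebbling_number[OF r])
    then obtain d' where d': "(pebbling_move H)\<^sup>*\<^sup>* (\<lambda>h. y (g, h)) d'" "1 \<le> d' r"
      unfolding solvable_def by blast
    have "solvable (G \<boxtimes> H) (g, r) (fibre_config g (\<lambda>h. y (g, h)))"
      unfolding solvable_def
      using fibre_moves[OF H.pair_wf_digraph_axioms g d'(1)] d'(2)
      by (intro exI[of _ "fibre_config g d'"]) simp
    then show ?thesis
    proof (rule solvable_mono)
      show "fibre_config g (\<lambda>h. y (g, h)) p \<le> x p" for p
        using y[of "fst p" "snd p"] by (cases p) (auto split: if_splits)
    qed
  qed
qed

section \<open>The bound\<close>

text \<open>
  The first summand of the bound pays for \<open>\<lceil>p / 2\<rceil>\<close> blocks, the second for the at most \<open>q\<close>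
  pebbles of each fibre that do not fill a block.  Counted double, the blocks form a
  configuration of \<open>G\<close> of size at least \<open>p\<close>.
\<close>

lemma solvable_strong_product:
  assumes "connected_graph G" and "connected_graph H"
    and g: "g \<in> pverts G" and r: "r \<in> pverts H"
    and size: "(pebbling_number H + 1) * ((pebbling_number G + 1) div 2)
      + card (pverts G) * pebbling_number H \<le> config_size (G \<boxtimes> H) x"
  shows "solvable (G \<boxtimes> H) (g, r) x"
proof -
  interpret G: connected_graph G by fact
  interpret H: connected_graph H by fact
  let ?m = "pebbling_number H + 1"
  define p where "p a = (\<Sum>h\<in>pverts H. x (a, h))" for a
  define c where "c a = 2 * (p a div ?m)" for a
  have "config_size (G \<boxtimes> H) x = (\<Sum>a\<in>pverts G. p a)"
    by (simp add: config_size_def strong_product_def p_def sum.cartesian_product)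
  also have "\<dots> \<le> (\<Sum>a\<in>pverts G. ?m * (p a div ?m) + pebbling_number H)"
  proof (rule sum_mono)
    fix a
    have "p a = ?m * (p a div ?m) + p a mod ?m" by (rule mult_div_mod_eq[symmetric])
    moreover have "p a mod ?m < ?m" by (rule mod_less_divisor) simp
    ultimately show "p a \<le> ?m * (p a div ?m) + pebbling_number H" by linarith
  qed
  also have "\<dots> = ?m * (\<Sum>a\<in>pverts G. p a div ?m) + card (pverts G) * pebbling_number H"
    by (simp only: sum.distrib sum_distrib_left sum_constant of_nat_id)
  finally have "?m * ((pebbling_number G + 1) div 2) \<le> ?m * (\<Sum>a\<in>pverts G. p a div ?m)"
    using size by linarith
  then have "(pebbling_number G + 1) div 2 \<le> (\<Sum>a\<in>pverts G. p a div ?m)"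
    by (simp only: mult_le_cancel1)
  then have "pebbling_number G \<le> (\<Sum>a\<in>pverts G. c a)"
    unfolding c_def sum_distrib_left[symmetric] by linarith
  then have "solvable G g c"
    by (rule G.solvable_if_size_ge_pebbling_number[OF g])
  then obtain c' where c': "(pebbling_move G)\<^sup>*\<^sup>* c c'" "1 \<le> c' g"
    unfolding solvable_def by blast
  have "simulates (pverts H) ?m r x c"
    unfolding simulates_def
    by (intro exI[of _ x] exI[of _ "\<lambda>a. p a div ?m"] exI[of _ "\<lambda>_. 0"])
      (simp add: c_def p_def[symmetric] times_div_less_eq_dividend del: mult_Suc)
  then obtain x' where x': "(pebbling_move (G \<boxtimes> H))\<^sup>*\<^sup>* x x'" "simulates (pverts H) ?m r x' c'"
    using simulate_moves[OF G.pair_graph_axioms assms(2) r _ c'(1)] by blast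
  then have "solvable (G \<boxtimes> H) (g, r) x'"
    using simulates_solvable[OF assms(2) r g] c'(2) by blast
  with x'(1) show ?thesis by (rule solvable_prepend_moves)
qed

theorem theorem4p1:
  fixes G :: "'a pair_pre_digraph" and H :: "'b pair_pre_digraph"
  assumes "pair_graph G" and "connected G"
    and "pair_graph H" and "connected H"
  shows "real (pebbling_number (G \<boxtimes> H))
    \<le> 3 / 2 * (real (pebbling_number G) + 1) * (real (pebbling_number H) + 1)"
proof -
  have G: "connected_graph G" and H: "connected_graph H"
    using assms by (auto intro!: connected_graph.intro connected_graph_axioms.intro)
  let ?p = "pebbling_number G" and ?q = "pebbling_number H"
  let ?N = "(?q + 1) * ((?p + 1) div 2) + card (pverts G) * ?q"
  have "pebbling_number (G \<boxtimes> H) \<le> ?N"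
    unfolding pebbling_number_def[of "G \<boxtimes> H"]
  proof (rule Least_le, intro ballI allI impI)
    fix v x
    assume "v \<in> pverts (G \<boxtimes> H)" and "configuration (G \<boxtimes> H) x \<and> config_size (G \<boxtimes> H) x = ?N"
    then show "solvable (G \<boxtimes> H) v x"
      using solvable_strong_product[OF G H, of "fst v" "snd v" x]
      by (auto simp: strong_product_def)
  qed
  also have "\<dots> \<le> (?q + 1) * ((?p + 1) div 2) + (?p + 1) * (?q + 1)"
    using connected_graph.card_verts_le_pebbling_number[OF G]
    by (intro add_left_mono mult_mono) auto
  finally have "real (pebbling_number (G \<boxtimes> H))
      \<le> real ((?q + 1) * ((?p + 1) div 2) + (?p + 1) * (?q + 1))"
    by (rule of_nat_mono)
  also have "\<dots> = (real ?q + 1) * real ((?p + 1) div 2) + (real ?p + 1) * (real ?q + 1)"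
    by (simp add: algebra_simps)
  also have "\<dots> \<le> (real ?q + 1) * ((real ?p + 1) / 2) + (real ?p + 1) * (real ?q + 1)"
    using of_nat_div_le_of_nat[of "?p + 1" 2, where ?'a = real]
    by (intro add_right_mono mult_left_mono) auto
  also have "\<dots> = 3 / 2 * (real ?p + 1) * (real ?q + 1)"
    by (simp add: field_simps)
  finally show ?thesis .
qed

end
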